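(* Consider the single-player pile game with boundary with set of choices $R=\{2,-1\}$ (probability $p$ of $+2$ and $q=1-p$ of $-1$), with generating functions $G_{n,s}(x)$, $0\le s\le n$. Write $G_{n,s}(x)=\dfrac{N_{n,s}(x)}{D_n(x)}$ for $0\le s\le n$, where $N_{n,s}(x)$ are polynomials and $D_n(x)$ is the common denominator, with constant term $1$, arising from solving the linear system for the $G_{n,s}(x)$ (as specified in the context). Then $D_n(x)$, as a sequence in $n$, satisfies $$D_n(x)=D_{n-1}(x)-p\,q^2x^3\,D_{n-3}(x)\qquad(n\ge3).$$
   Context: Single-player pile game with boundary, $R=\{2,-1\}$: the player starts with $s\ge0$ chips. In each turn, independently, the number of chips $c$ is replaced by $c+2$ with probability $p$ and by $\max(0,c-1)$ with probability $q=1-p$. The game ends when the player first has $n$ chips or more (at turn $0$ if $s\ge n$). $B_n(k,s)$ is the probability that the game ends at the $k$-th turn, and $G_{n,s}(x)=\sum_{k\ge0}B_n(k,s)x^k$. These functions satisfy the linear system $G_{n,0}=pxG_{n,2}+qxG_{n,0}$, $G_{n,s}=pxG_{n,s+2}+qxG_{n,s-1}$ for $1\le s<n$, with $G_{n,s}=1$ for $s\ge n$. Writing it as a system in the $n$ unknowns $G_{n,0},\dots,G_{n,n-1}$ with coefficient matrix $I-xM_n$, where $M_n$ is the matrix of one-step transition probabilities among the states $0,\dots,n-1$, Cramer's rule gives the common denominator $D_n(x)=\det(I-xM_n)$, which has constant term $1$ (and $D_0(x)=1$). *)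

theory Defs
  imports
    "HOL-Probability.Stream_Space"
    "HOL-Probability.Probability_Mass_Function"
    "HOL-Computational_Algebra.Polynomial_FPS"
    "Jordan_Normal_Form.Determinant"
begin

definition choice_pmf :: "real \<Rightarrow> int pmf" where
  "choice_pmf p = map_pmf (\<lambda>b. if b then 2 else -1) (bernoulli_pmf p)"

definition move :: "nat \<Rightarrow> int \<Rightarrow> nat" where
  "move c r = nat (max 0 (int c + r))"

text \<open>
  The number of chips after \<open>k\<close> turns, starting with \<open>s\<close> chips, when \<open>\<omega>\<close> is the sequence of
  choices. The walk is continued past the end of the game; only the first passage to \<open>n\<close> or more
  chips matters below.
\<close>

primrec chips :: "nat \<Rightarrow> int stream \<Rightarrow> nat \<Rightarrow> nat" where
  "chips s \<omega> 0 = s"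
| "chips s \<omega> (Suc k) = move (chips s \<omega> k) (\<omega> !! k)"

definition ends_at :: "nat \<Rightarrow> nat \<Rightarrow> nat \<Rightarrow> int stream \<Rightarrow> bool" where
  "ends_at n k s \<omega> \<longleftrightarrow> n \<le> chips s \<omega> k \<and> (\<forall>j<k. chips s \<omega> j < n)"

definition B :: "real \<Rightarrow> nat \<Rightarrow> nat \<Rightarrow> nat \<Rightarrow> real" where
  "B p n k s = measure (stream_space (measure_pmf (choice_pmf p))) {\<omega>. ends_at n k s \<omega>}"

definition G :: "real \<Rightarrow> nat \<Rightarrow> nat \<Rightarrow> real fps" where
  "G p n s = Abs_fps (\<lambda>k. B p n k s)"

definition transition_mat :: "real \<Rightarrow> nat \<Rightarrow> real Matrix.mat" where
  "transition_mat p n = Matrix.mat n n (\<lambda>(i, j). pmf (map_pmf (move i) (choice_pmf p)) j)"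

text \<open>
  The determinant of \<open>I - x M\<close>, where \<open>x\<close> is the polynomial indeterminate and \<open>M\<close> is the
  transition matrix on the states \<open>0, \<dots>, n - 1\<close>. It is \<open>1\<close> for \<open>n = 0\<close>.
\<close>

definition D :: "real \<Rightarrow> nat \<Rightarrow> real poly" where
  "D p n = Determinant.det
    (1\<^sub>m n - [:0, 1:] \<cdot>\<^sub>m map_mat (\<lambda>a. [:a:]) (transition_mat p n))"

end

theory Submission imports Defs begin

text \<open>
  The matrix \<open>I - x M\<^sub>n\<close> has last row \<open>(0, \<dots>, 0, -q x, 1)\<close>, and its last column has the two nonzero
  entries \<open>-p x\<close> (row \<open>n - 3\<close>) and \<open>1\<close> (row \<open>n - 1\<close>). Expanding along the last column, the second
  entry contributes \<open>D\<^sub>n\<^sub>-\<^sub>1\<close>. In the minor of the first, the last two rows can be split off one after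
  the other, each with the single nonzero entry \<open>-q x\<close>, so this minor is \<open>q\<^sup>2 x\<^sup>2 D\<^sub>n\<^sub>-\<^sub>3\<close>. The form of
  the generating functions follows from first-step analysis and Cramer's rule.
\<close>

lemma move_2: "move c 2 = c + 2" and move_minus_1: "move c (- 1) = c - 1"
  by (auto simp: move_def)

lemma pmf_move_choice_pmf:
  assumes "0 \<le> p" "p \<le> 1"
  shows "pmf (map_pmf (move i) (choice_pmf p)) j =
    (if j = i - 1 then 1 - p else 0) + (if j = i + 2 then p else 0)"
proof -
  have "map_pmf (move i) (choice_pmf p) = map_pmf (\<lambda>b. if b then i + 2 else i - 1) (bernoulli_pmf p)"
    unfolding choice_pmf_def map_pmf_comp by (intro map_pmf_cong) (simp_all add: move_2 move_minus_1)
  also have "pmf \<dots> j = (if j = i - 1 then 1 - p else 0) + (if j = i + 2 then p else 0)"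
    using assms by (simp add: map_pmf_def pmf_bind indicator_def)
  finally show ?thesis .
qed

text \<open>Truncated subtraction in \<open>i - 1\<close> accounts for the boundary: the entry at \<open>(0, 0)\<close> is \<open>1 - q x\<close>.\<close>

definition system_mat :: "real \<Rightarrow> nat \<Rightarrow> real poly Matrix.mat" where
  "system_mat p n = Matrix.mat n n (\<lambda>(i, j).
     (if i = j then 1 else 0) - (if j = i - 1 then [:0, 1 - p:] else 0)
       - (if j = i + 2 then [:0, p:] else 0))"

lemma system_mat_carrier [simp]: "system_mat p n \<in> carrier_mat n n"
  and dim_system_mat [simp]: "dim_row (system_mat p n) = n" "dim_col (system_mat p n) = n"
  by (simp_all add: system_mat_def)

lemma D_eq_det_system_mat:
  assumes "0 \<le> p" "p \<le> 1"
  shows "D p n = Determinant.det (system_mat p n)"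
proof -
  have "1\<^sub>m n - [:0, 1:] \<cdot>\<^sub>m map_mat (\<lambda>a. [:a:]) (transition_mat p n) = system_mat p n"
    using assms
    by (intro eq_matI) (auto simp: system_mat_def transition_mat_def pmf_move_choice_pmf)
  then show ?thesis by (simp add: D_def)
qed

text \<open>Taking the constant coefficient is a ring homomorphism, so it commutes with the
  determinant; it sends \<open>I - x M\<close> to the identity matrix.\<close>

lemma coeff_0_D: "coeff (D p n) 0 = 1"
proof -
  interpret h: comm_ring_hom "\<lambda>f :: real poly. coeff f 0"
    by unfold_locales (auto simp: coeff_mult)
  let ?A = "1\<^sub>m n - [:0, 1:] \<cdot>\<^sub>m map_mat (\<lambda>a. [:a:]) (transition_mat p n)"
  have "map_mat (\<lambda>f. coeff f 0) ?A = 1\<^sub>m n"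
    by (intro eq_matI) (auto simp: transition_mat_def)
  then show ?thesis
    unfolding D_def by (metis h.hom_det det_one)
qed

lemma det_eq_last_entry_times_minor:
  fixes A :: "'a :: comm_ring_1 Matrix.mat"
  assumes A: "A \<in> carrier_mat (Suc n) (Suc n)" and "\<And>j. j < n \<Longrightarrow> A $$ (n, j) = 0"
  shows "Determinant.det A = A $$ (n, n) * Determinant.det (mat_delete A n n)"
  using assms(2) by (subst laplace_expansion_row[OF A, of n]) (auto simp: cofactor_def)

lemma det_system_mat_recurrence:
  "Determinant.det (system_mat p (m + 3)) =
     Determinant.det (system_mat p (m + 2)) -
     monom (p * (1 - p) ^ 2) 3 * Determinant.det (system_mat p m)"
proof -
  define A where "A = system_mat p (m + 3)"
  \<comment> \<open>Deleting row \<open>m\<close> moves the two rows below it up by one, so their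
    subdiagonal entries \<open>-q x\<close> land on the diagonal of \<open>C\<close>, in the two
    bottom rows.\<close>
  define C where "C = mat_delete A m (m + 2)"
  define E where "E = mat_delete C (m + 1) (m + 1)"
  have A: "A \<in> carrier_mat (m + 3) (m + 3)" by (simp add: A_def)
  have C: "C \<in> carrier_mat (Suc (m + 1)) (Suc (m + 1))"
    using mat_delete_carrier[OF A, of m "m + 2"] by (simp add: C_def)
  have E: "E \<in> carrier_mat (Suc m) (Suc m)"
    using mat_delete_carrier[OF C, of "m + 1" "m + 1"] by (simp add: E_def)
  note entries = A_def C_def E_def mat_delete_def system_mat_def
  have "mat_delete A (m + 2) (m + 2) = system_mat p (m + 2)"
    by (intro eq_matI) (auto simp: entries)
  moreover have "Determinant.det A = (\<Sum>i<m + 3. A $$ (i, m + 2) * cofactor A i (m + 2))"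
    by (rule laplace_expansion_column[OF A]) simp
  moreover have "\<dots> = (\<Sum>i\<in>{m, m + 2}. A $$ (i, m + 2) * cofactor A i (m + 2))"
    by (intro sum.mono_neutral_right) (auto simp: entries)
  moreover have "A $$ (m, m + 2) = - [:0, p:]" "A $$ (m + 2, m + 2) = 1"
    by (auto simp: entries)
  \<comment> \<open>Both cofactors have sign \<open>+1\<close>, as the row indices \<open>m\<close>
    and \<open>m + 2\<close> have the same parity as the column index \<open>m + 2\<close>.\<close>
  ultimately have detA: "Determinant.det A =
      Determinant.det (system_mat p (m + 2)) - [:0, p:] * Determinant.det C"
    by (simp add: cofactor_def C_def)
  have "Determinant.det C = C $$ (m + 1, m + 1) * Determinant.det E"
    unfolding E_def by (rule det_eq_last_entry_times_minor[OF C]) (auto simp: entries)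
  moreover have "Determinant.det E = E $$ (m, m) * Determinant.det (mat_delete E m m)"
    by (rule det_eq_last_entry_times_minor[OF E]) (auto simp: entries)
  moreover have "mat_delete E m m = system_mat p m"
    by (intro eq_matI) (auto simp: entries)
  moreover have "C $$ (m + 1, m + 1) = - [:0, 1 - p:]" "E $$ (m, m) = - [:0, 1 - p:]"
    by (auto simp: entries)
  ultimately have detC: "Determinant.det C =
      [:0, 1 - p:] * [:0, 1 - p:] * Determinant.det (system_mat p m)"
    by (simp only: mult.assoc minus_mult_minus)
  have "[:0, p:] * ([:0, 1 - p:] * [:0, 1 - p:]) = monom (p * (1 - p) ^ 2) 3"
    by (simp add: monom_altdef numeral_3_eq_3 power2_eq_square algebra_simps)
  then show ?thesis
    using detA unfolding A_def detC by (metis mult.assoc)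
qed

text \<open>The recursion of \<open>chips\<close> peels off the last choice, whereas first-step
  analysis has to peel off the first one.\<close>

lemma chips_Stream: "chips s (r ## \<omega>) (Suc k) = chips (move s r) \<omega> k"
  by (induction k) auto

lemma ends_at_Suc_Stream:
  "ends_at n (Suc k) s (r ## \<omega>) \<longleftrightarrow> s < n \<and> ends_at n k (move s r) \<omega>"
proof -
  have "(\<forall>j<Suc k. chips s (r ## \<omega>) j < n) \<longleftrightarrow> s < n \<and> (\<forall>j<k. chips (move s r) \<omega> j < n)"
    \<comment> \<open>\<open>All_less_Suc2\<close> splits off turn 0, which contributes
      \<open>s < n\<close>.\<close>
    unfolding All_less_Suc2 chips_Stream by simp
  then show ?thesis unfolding ends_at_def chips_Stream by auto
qed

lemma measurable_chips [measurable]: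
  "(\<lambda>\<omega>. chips s \<omega> k) \<in> stream_space (measure_pmf P) \<rightarrow>\<^sub>M count_space UNIV"
proof (induction k)
  case (Suc k)
  have [measurable]: "(\<lambda>\<omega>. \<omega> !! k) \<in> stream_space (measure_pmf P) \<rightarrow>\<^sub>M count_space UNIV"
    using measurable_snth[of k "measure_pmf P"] by (simp cong: measurable_cong_sets)
  note [measurable] = Suc
  show ?case by simp
qed simp

lemma measurable_ends_at [measurable]:
  "Measurable.pred (stream_space (measure_pmf P)) (ends_at n k s)"
  unfolding ends_at_def by measurable

lemma B_0: "B p n 0 s = (if n \<le> s then 1 else 0)"
proof -
  interpret S: prob_space "stream_space (measure_pmf (choice_pmf p))"
    by (intro prob_space.prob_space_stream_space measure_pmf.prob_space_axioms)
  show ?thesis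
    using S.prob_space by (auto simp: B_def ends_at_def space_stream_space)
qed

text \<open>Condition on the first choice: the remaining choices are again independent with the same
  distribution. From \<open>s \<ge> n\<close> the game is over at turn 0. At \<open>s = 0\<close>
  the truncated \<open>s - 1\<close> is the boundary rule.\<close>

lemma B_Suc:
  assumes "0 \<le> p" "p \<le> 1"
  shows "B p n (Suc k) s = (if s < n then p * B p n k (s + 2) + (1 - p) * B p n k (s - 1) else 0)"
proof -
  let ?S = "stream_space (measure_pmf (choice_pmf p))"
  have space: "space ?S = UNIV" by (simp add: space_stream_space)
  have "ennreal (B p n (Suc k) s) =
      (\<integral>\<^sup>+r. measure ?S {\<omega>. ends_at n (Suc k) s (r ## \<omega>)} \<partial>choice_pmf p)"
    using prob_space.prob_stream_space[OF measure_pmf.prob_space_axioms, of "choice_pmf p" "ends_at n (Suc k) s",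
        OF measurable_ends_at[unfolded pred_def]]
    by (simp add: B_def space)
  also have "\<dots> = (\<integral>\<^sup>+r. (if s < n then B p n k (move s r) else 0) \<partial>choice_pmf p)"
    by (intro nn_integral_cong) (simp add: ends_at_Suc_Stream B_def)
  also have "\<dots> = ennreal (if s < n then p * B p n k (s + 2) + (1 - p) * B p n k (s - 1) else 0)"
    using assms
    by (simp add: choice_pmf_def move_2 move_minus_1 B_def ennreal_mult'' ennreal_plus mult.commute)
  \<comment> \<open>Both sides are nonnegative, so the identity descends from \<open>ennreal\<close>
    to the reals.\<close>
  finally show ?thesis
    using assms by (subst (asm) ennreal_inj) (auto simp: B_def)
qed

lemma G_eq_1:
  assumes "0 \<le> p" "p \<le> 1" "n \<le> s"
  shows "G p n s = 1"
proof (rule fps_ext)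
  fix k show "fps_nth (G p n s) k = fps_nth 1 k"
    using assms by (cases k) (auto simp: G_def B_0 B_Suc)
qed

lemma G_recurrence:
  assumes "0 \<le> p" "p \<le> 1" "s < n"
  shows "G p n s = fps_X * (fps_const p * G p n (s + 2) + fps_const (1 - p) * G p n (s - 1))"
proof (rule fps_ext)
  fix k show "fps_nth (G p n s) k =
      fps_nth (fps_X * (fps_const p * G p n (s + 2) + fps_const (1 - p) * G p n (s - 1))) k"
    using assms by (cases k) (auto simp: G_def B_0 B_Suc)
qed

text \<open>This is the linear system with right-hand side separated: in the rows with
  \<open>i + 2 \<ge> n\<close> the term \<open>p x G\<close> has \<open>G = 1\<close> and is
  known.\<close>

lemma system_mat_G:
  assumes "0 \<le> p" "p \<le> 1" "i < n"
  shows "(\<Sum>j<n. fps_of_poly (system_mat p n $$ (i, j)) * G p n j) =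
    fps_of_poly (if i + 2 < n then 0 else [:0, p:])"
proof -
  have X: "fps_of_poly [:0, c:] = fps_X * fps_const c" for c :: real
    by (simp add: fps_of_poly_pCons)
  have "(\<Sum>j<n. fps_of_poly (system_mat p n $$ (i, j)) * G p n j) =
      (\<Sum>j<n. (if j = i then G p n j else 0)
        - (if j = i - 1 then fps_of_poly [:0, 1 - p:] * G p n j else 0)
        - (if j = i + 2 then fps_of_poly [:0, p:] * G p n j else 0))"
    using assms
    by (intro sum.cong) (auto simp: system_mat_def fps_of_poly_diff left_diff_distrib)
  also have "\<dots> = G p n i - fps_of_poly [:0, 1 - p:] * G p n (i - 1)
      - (if i + 2 < n then fps_of_poly [:0, p:] * G p n (i + 2) else 0)"
    using assms by (simp add: sum_subtractf)
  also have "\<dots> = fps_of_poly (if i + 2 < n then 0 else [:0, p:])"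
    using assms G_eq_1[of p n "i + 2"]
    by (subst G_recurrence) (auto simp: X algebra_simps)
  finally show ?thesis .
qed

text \<open>Cramer's rule in the form adjugate times matrix equals determinant times identity:
  combining the equations with row \<open>s\<close> of the adjugate isolates the unknown with index
  \<open>s\<close>. The adjugate and the right-hand side are polynomial, hence so is the
  result.\<close>

lemma D_mult_G:
  assumes "0 \<le> p" "p \<le> 1" "s < n"
  obtains N where "fps_of_poly (D p n) * G p n s = fps_of_poly N"
proof
  let ?A = "system_mat p n"
  let ?r = "\<lambda>i. if i + 2 < n then 0 else [:0, p:]"
  note adj = adj_mat[OF system_mat_carrier, of p n]
  have adj_entry: "(\<Sum>i<n. adj_mat ?A $$ (s, i) * ?A $$ (i, j)) = (if s = j then D p n else 0)"
    if "j < n" for j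
  proof -
    have "(\<Sum>i<n. adj_mat ?A $$ (s, i) * ?A $$ (i, j)) = (adj_mat ?A * ?A) $$ (s, j)"
      using that assms adj(1)
      by (subst index_mult_mat) (auto simp: scalar_prod_def atLeast0LessThan intro!: sum.cong)
    then show ?thesis
      using that assms by (simp add: adj(3) D_eq_det_system_mat)
  qed
  have "fps_of_poly (\<Sum>i<n. adj_mat ?A $$ (s, i) * ?r i) =
      (\<Sum>i<n. fps_of_poly (adj_mat ?A $$ (s, i)) *
        (\<Sum>j<n. fps_of_poly (?A $$ (i, j)) * G p n j))"
    using assms by (simp add: fps_of_poly_sum fps_of_poly_mult system_mat_G)
  also have "\<dots> = (\<Sum>j<n. fps_of_poly (\<Sum>i<n. adj_mat ?A $$ (s, i) * ?A $$ (i, j)) * G p n j)"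
    unfolding sum_distrib_left fps_of_poly_sum fps_of_poly_mult sum_distrib_right
    by (subst sum.swap) (simp add: mult.assoc)
  also have "\<dots> = (\<Sum>j<n. if j = s then fps_of_poly (D p n) * G p n j else 0)"
    by (intro sum.cong) (auto simp: adj_entry)
  also have "\<dots> = fps_of_poly (D p n) * G p n s"
    using assms by simp
  finally show "fps_of_poly (D p n) * G p n s = fps_of_poly (\<Sum>i<n. adj_mat ?A $$ (s, i) * ?r i)"
    by simp
qed

theorem corollary13:
  fixes p q :: real
  assumes "0 \<le> p" and "p \<le> 1" and "q = 1 - p"
  shows "(\<forall>n. coeff (D p n) 0 = 1 \<and>
            (\<exists>N :: nat \<Rightarrow> real poly. \<forall>s\<le>n. G p n s = fps_of_poly (N s) / fps_of_poly (D p n)))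
       \<and> (\<forall>n\<ge>3. D p n = D p (n - 1) - monom (p * q ^ 2) 3 * D p (n - 3))"
proof (intro conjI allI impI)
  fix n
  show "coeff (D p n) 0 = 1" by (rule coeff_0_D)
  then have nz: "fps_of_poly (D p n) \<noteq> 0" by auto
  have "\<exists>N. fps_of_poly (D p n) * G p n s = fps_of_poly N" for s
  proof (cases "s < n")
    case True
    then show ?thesis using assms D_mult_G by metis
  next
    case False
    \<comment> \<open>Here the series is \<open>1\<close>, so the numerator is the denominator
      itself; this covers \<open>s = n\<close>.\<close>
    then show ?thesis using assms G_eq_1 by (intro exI[of _ "D p n"]) simp
  qed
  then obtain N where "\<And>s. fps_of_poly (D p n) * G p n s = fps_of_poly (N s)" by metis
  then have "\<forall>s\<le>n. G p n s = fps_of_poly (N s) / fps_of_poly (D p n)"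
    using nz by (metis nonzero_mult_div_cancel_left)
  then show "\<exists>N :: nat \<Rightarrow> real poly. \<forall>s\<le>n. G p n s = fps_of_poly (N s) / fps_of_poly (D p n)"
    by blast
next
  fix n :: nat
  assume "n \<ge> 3"
  then obtain m where "n = m + 3" by (metis add.commute le_Suc_ex)
  then show "D p n = D p (n - 1) - monom (p * q ^ 2) 3 * D p (n - 3)"
    using det_system_mat_recurrence[of p m] assms by (simp add: D_eq_det_system_mat)
qed

end
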